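(* Let $G$ be a CDF on $\mathbb{R}$ with finite second moment, mean $\mu_G$ and standard deviation $\sigma_G>0$, and let $\epsilon>0$, $\gamma>0$. Consider the best-case problem $$\inf_{F\in\mathcal{M}^2(G;\epsilon)} V^F(X),\qquad V^F(X)=\mathbb{E}_F[X]+\gamma\,\mathbb{V}_F[X].$$ The equation $$\tan(\theta)-2\gamma\sigma_G-2\gamma\sqrt{\epsilon}\,\sin(\theta)=0,\qquad \theta\in\left(\pi,\tfrac{3}{2}\pi\right),$$ has a unique root $\theta^*$, and the optimal quantile function of the best-case distribution $F_{be}$ (the minimizer of the problem) is given by $$F_{be}^{-1}(t)=(\mu_G+\sqrt{\epsilon}\cos(\theta^* ))+(\sigma_G+\sqrt{\epsilon}\sin(\theta^* ))\,\frac{G^{-1}(t)-\mu_G}{\sigma_G}.$$ Moreover, the best-case value is $$\inf_{F\in\mathcal{M}^2(G;\epsilon)}V^F(X)=\mu_G+\frac{\lambda^*\gamma}{\lambda^*+\gamma}\sigma_G^2-\frac{1}{4\lambda^*}-\lambda^*\epsilon,$$ where $\lambda^*$ is the unique positive solution of $$\frac{\gamma^2\sigma_G^2}{(\lambda+\gamma)^2}+\frac{1}{4\lambda^2}=\epsilon.$$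
   Context: For a CDF $F$ on $\mathbb{R}$, $F^{-1}(t)=\inf\{x\in\mathbb{R}:F(x)\ge t\}$ is its left-continuous quantile function. $\mathbb{E}_F[X]=\int_0^1F^{-1}(t)\,dt$ and $\mathbb{V}_F[X]=\int_0^1 (F^{-1}(t))^2dt-\left(\int_0^1F^{-1}(t)dt\right)^2$ are the mean and variance of a random variable $X$ with CDF $F$. The 2-Wasserstein distance between CDFs with finite second moments is $W_2(F,G)=\left(\int_0^1|F^{-1}(t)-G^{-1}(t)|^2dt\right)^{1/2}$. $\mathcal{M}^2(G;\epsilon)$ is the set of all CDFs $F$ on $\mathbb{R}$ with finite second moment such that $W_2(F,G)\le\sqrt{\epsilon}$. *)

theory Defs
  imports "HOL-Probability.Probability"
begin

definition is_cdf :: "(real \<Rightarrow> real) \<Rightarrow> bool" where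
  "is_cdf F \<longleftrightarrow> (\<exists>M. real_distribution M \<and> F = cdf M)"

(* Meaningful for 0 < t < 1 only: outside this range the set may be empty or unbounded below,
   and then Inf is unspecified.  All integrals below are over the open unit interval. *)
definition quantile :: "(real \<Rightarrow> real) \<Rightarrow> real \<Rightarrow> real" where
  "quantile F t = Inf {x. F x \<ge> t}"

(* interval_measure F is the law with CDF F whenever F is a CDF. *)
definition finite_second_moment :: "(real \<Rightarrow> real) \<Rightarrow> bool" where
  "finite_second_moment F \<longleftrightarrow> integrable (interval_measure F) (\<lambda>x. x\<^sup>2)"

definition cdf_mean :: "(real \<Rightarrow> real) \<Rightarrow> real" where
  "cdf_mean F = (LBINT t:{0<..<1}. quantile F t)"

definition cdf_variance :: "(real \<Rightarrow> real) \<Rightarrow> real" where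
  "cdf_variance F =
     (LBINT t:{0<..<1}. (quantile F t)\<^sup>2) - (LBINT t:{0<..<1}. quantile F t)\<^sup>2"

definition wasserstein2 :: "(real \<Rightarrow> real) \<Rightarrow> (real \<Rightarrow> real) \<Rightarrow> real" where
  "wasserstein2 F G = sqrt (LBINT t:{0<..<1}. \<bar>quantile F t - quantile G t\<bar>\<^sup>2)"

definition wasserstein_ball :: "(real \<Rightarrow> real) \<Rightarrow> real \<Rightarrow> (real \<Rightarrow> real) set" where
  "wasserstein_ball G \<epsilon> =
     {F. is_cdf F \<and> finite_second_moment F \<and> wasserstein2 F G \<le> sqrt \<epsilon>}"

definition mean_variance :: "real \<Rightarrow> (real \<Rightarrow> real) \<Rightarrow> real" where
  "mean_variance \<gamma> F = cdf_mean F + \<gamma> * cdf_variance F"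

end

(*
  Work with quantile functions q = F^{-1} and g = G^{-1} as random variables on (0,1), and let
  l > 0 be a Lagrange multiplier for the ball constraint.  Completing squares in the penalized objective gives
    V(F) + l * W(F,G)^2 = const + (l + gamma) * E[h^2] + l * (E q - E g + 1 / (2l))^2,
    h = (q - E q) - l / (l + gamma) * (g - E g),
  so over the ball V is minimized exactly when both squares vanish and the constraint is tight.
  Vanishing squares determine q as an increasing affine image of g, which is a quantile
  function, and tightness is the equation for l.  The pair (change of the mean, change of the
  standard deviation) has norm sqrt epsilon; its polar angle is theta.
*)

theory Submission
  imports Defs
begin

section \<open>Quantile functions on the unit interval\<close>

abbreviation unit_interval :: "real measure" where
  "unit_interval \<equiv> restrict_space lborel {0<..<1}"

lemma prob_space_unit_interval: "prob_space unit_interval"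
  by (auto simp: emeasure_restrict_space space_restrict_space intro!: prob_spaceI)

lemma set_integral_unit_interval:
  fixes f :: "real \<Rightarrow> real"
  shows "(LBINT t:{0<..<1}. f t) = integral\<^sup>L unit_interval f"
  by (simp add: set_lebesgue_integral_def integral_restrict_space)

context
  fixes F :: "real \<Rightarrow> real"
  assumes F: "is_cdf F"
begin

text \<open>The pseudoinverse of the locale \<open>cdf_distribution\<close> is the same infimum, so
  its facts on the quantile transform carry over to \<open>quantile\<close>.\<close>

lemma quantile_eq_pseudoinverse:
  obtains M where "cdf_distribution M" "F = cdf M" "quantile F = (\<lambda>t. Inf {x. t \<le> cdf M x})"
  using F by (auto simp: is_cdf_def cdf_distribution_def quantile_def fun_eq_iff)

text \<open>Right-continuity of \<open>F\<close> makes the infimum attained, hence this Galois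
  connection; it determines \<open>quantile F t\<close> through its upper bounds.\<close>

lemma quantile_le_iff:
  assumes "0 < t" "t < 1"
  shows "quantile F t \<le> x \<longleftrightarrow> t \<le> F x"
proof -
  obtain M where M: "cdf_distribution M" "F = cdf M" "quantile F = (\<lambda>t. Inf {x. t \<le> cdf M x})"
    by (rule quantile_eq_pseudoinverse)
  interpret cdf_distribution M by (rule M(1))
  show ?thesis
    unfolding M(3) unfolding M(2) by (rule pseudoinverse[OF assms, symmetric])
qed

lemma borel_measurable_quantile: "quantile F \<in> borel_measurable unit_interval"
proof -
  obtain M where M: "cdf_distribution M" "F = cdf M" "quantile F = (\<lambda>t. Inf {x. t \<le> cdf M x})"
    by (rule quantile_eq_pseudoinverse)
  interpret cdf_distribution M by (rule M(1))
  have "(borel_measurable unit_interval :: (real \<Rightarrow> real) set) =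
      borel_measurable (restrict_space borel {0<..<1})"
    by (intro measurable_cong_sets sets_restrict_space_cong) auto
  then show ?thesis
    unfolding M(3) using measurable_CI by (rule ssubst)
qed

lemma cdf_distr_quantile: "cdf (distr unit_interval borel (quantile F)) = F"
proof -
  obtain M where M: "cdf_distribution M" "F = cdf M" "quantile F = (\<lambda>t. Inf {x. t \<le> cdf M x})"
    by (rule quantile_eq_pseudoinverse)
  interpret cdf_distribution M by (rule M(1))
  show ?thesis
    unfolding M(3) distr_I_eq_M by (rule M(2)[symmetric])
qed

text \<open>Inverse transform sampling: under the uniform law, the quantile function has the law
  with CDF \<open>F\<close>. This turns the second moment with respect to
  \<open>interval_measure F\<close> into an integral over the unit interval.\<close>

lemma distr_quantile: "distr unit_interval borel (quantile F) = interval_measure F"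
proof -
  obtain M where M: "cdf_distribution M" "F = cdf M" "quantile F = (\<lambda>t. Inf {x. t \<le> cdf M x})"
    by (rule quantile_eq_pseudoinverse)
  interpret cdf_distribution M by (rule M(1))
  note cdf_props = cdf_nondecreasing cdf_is_right_cont cdf_lim_at_bot cdf_lim_at_top_prob
  have "interval_measure (cdf M) = M"
    by (rule cdf_unique[OF real_distribution_interval_measure[OF cdf_props] real_distribution_axioms
          cdf_interval_measure[OF cdf_props(1-3)]])
  then show ?thesis
    by (subst M(3)) (simp only: distr_I_eq_M M(2))
qed

lemma finite_second_moment_iff_quantile:
  "finite_second_moment F \<longleftrightarrow> integrable unit_interval (\<lambda>t. (quantile F t)\<^sup>2)"
  unfolding finite_second_moment_def distr_quantile[symmetric]
  by (rule integrable_distr_eq[OF borel_measurable_quantile]) simp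

end

text \<open>The pushforward of the uniform law sees a quantile function only up to null sets and
  still recovers the CDF. This upgrades an almost-everywhere identity to uniqueness of the
  minimizer.\<close>

lemma cdf_eqI_AE_quantile:
  assumes F: "is_cdf F" and G: "is_cdf G"
    and "AE t in unit_interval. quantile F t = quantile G t"
  shows "F = G"
proof -
  have "distr unit_interval borel (quantile F) = distr unit_interval borel (quantile G)"
    by (rule distr_cong_AE[OF refl refl assms(3) borel_measurable_quantile[OF F]
          borel_measurable_quantile[OF G]])
  then show ?thesis
    by (metis cdf_distr_quantile F G)
qed

text \<open>The function is the CDF of \<open>b + c * X\<close> when \<open>X\<close> has CDF
  \<open>G\<close>; \<open>c > 0\<close> keeps the direction of the inequality.\<close>

lemma is_cdf_affine:
  assumes "is_cdf G" "c > 0"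
  shows "is_cdf (\<lambda>x. G ((x - b) / c))"
proof -
  obtain M where M: "real_distribution M" "G = cdf M"
    using assms by (auto simp: is_cdf_def)
  interpret real_distribution M by (rule M(1))
  have "(\<lambda>x. G ((x - b) / c)) = cdf (distr M borel (\<lambda>x. b + c * x))"
    unfolding M(2) cdf_def
    using \<open>c > 0\<close>
    by (intro ext, subst measure_distr) (auto intro!: arg_cong[where f = prob] simp: field_simps)
  moreover have "real_distribution (distr M borel (\<lambda>x. b + c * x))"
    by (rule real_distribution_distr) simp
  ultimately show ?thesis
    unfolding is_cdf_def by blast
qed

text \<open>By \<open>quantile_le_iff\<close> both sides have the same upper bounds, so they
  agree.\<close>

lemma quantile_affine:
  assumes G: "is_cdf G" and c: "c > 0" and t: "0 < t" "t < 1"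
  shows "quantile (\<lambda>x. G ((x - b) / c)) t = b + c * quantile G t"
proof -
  have iff: "quantile (\<lambda>x. G ((x - b) / c)) t \<le> x \<longleftrightarrow> b + c * quantile G t \<le> x" for x
  proof -
    have "quantile (\<lambda>x. G ((x - b) / c)) t \<le> x \<longleftrightarrow> quantile G t \<le> (x - b) / c"
      unfolding quantile_le_iff[OF is_cdf_affine[OF G c] t] quantile_le_iff[OF G t] ..
    also have "\<dots> \<longleftrightarrow> b + c * quantile G t \<le> x"
      unfolding pos_le_divide_eq[OF c] by (simp add: le_diff_eq ac_simps)
    finally show ?thesis .
  qed
  show ?thesis
    by (rule order_antisym[OF iffD2[OF iff order_refl] iffD1[OF iff order_refl]])
qed

section \<open>The penalized problem\<close>

text \<open>Since E[(q - g)^2] = Var(q - g) + (E q - E g)^2, the objective separates into a centered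
  part and a mean part. The factor \<open>k\<close> minimizes the first among multiples of the
  centered \<open>g\<close>; the second has its vertex at E g - 1 / (2l).\<close>

lemma (in prob_space) mean_variance_complete_squares:
  fixes q g :: "'a \<Rightarrow> real"
  assumes [measurable]: "q \<in> borel_measurable M" "g \<in> borel_measurable M"
    and q2: "integrable M (\<lambda>x. (q x)\<^sup>2)" and g2: "integrable M (\<lambda>x. (g x)\<^sup>2)"
    and "l > 0" "\<gamma> > 0"
  defines "k \<equiv> l / (l + \<gamma>)"
  defines "h \<equiv> \<lambda>x. (q x - expectation q) - k * (g x - expectation g)"
  shows "integrable M (\<lambda>x. (h x)\<^sup>2)"
    and "expectation q + \<gamma> * (expectation (\<lambda>x. (q x)\<^sup>2) - (expectation q)\<^sup>2)
           + l * expectation (\<lambda>x. (q x - g x)\<^sup>2)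
         = expectation g + l * \<gamma> / (l + \<gamma>) * (expectation (\<lambda>x. (g x)\<^sup>2) - (expectation g)\<^sup>2)
           - 1 / (4 * l) + (l + \<gamma>) * expectation (\<lambda>x. (h x)\<^sup>2)
           + l * (expectation q - expectation g + 1 / (2 * l))\<^sup>2"
proof -
  have q1: "integrable M q"
    by (rule square_integrable_imp_integrable[OF assms(1) q2])
  have g1: "integrable M g"
    by (rule square_integrable_imp_integrable[OF assms(2) g2])
  have qg: "integrable M (\<lambda>x. q x * g x)"
  proof (rule Bochner_Integration.integrable_bound)
    show "integrable M (\<lambda>x. (q x)\<^sup>2 + (g x)\<^sup>2)"
      using q2 g2 by simp
    have "\<bar>a * b\<bar> \<le> a\<^sup>2 + b\<^sup>2" for a b :: real
      using sum_squares_bound[of "\<bar>a\<bar>" "\<bar>b\<bar>"] abs_ge_zero[of "a * b"]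
      by (simp only: abs_mult power2_abs)
    then show "AE x in M. norm (q x * g x) \<le> norm ((q x)\<^sup>2 + (g x)\<^sup>2)"
      by simp
  qed simp
  define m n A B C where "m = expectation q" and "n = expectation g"
    and "A = expectation (\<lambda>x. (q x)\<^sup>2)" and "B = expectation (\<lambda>x. (g x)\<^sup>2)"
    and "C = expectation (\<lambda>x. q x * g x)"
  note moments = m_def[symmetric] n_def[symmetric] A_def[symmetric] B_def[symmetric] C_def[symmetric]
  have h2: "(\<lambda>x. (h x)\<^sup>2) = (\<lambda>x. (q x)\<^sup>2 + k\<^sup>2 * (g x)\<^sup>2 - 2 * k * (q x * g x)
      - 2 * (m - k * n) * q x + 2 * k * (m - k * n) * g x + (m - k * n)\<^sup>2)"
    by (simp add: fun_eq_iff h_def moments power2_eq_square algebra_simps)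
  show "integrable M (\<lambda>x. (h x)\<^sup>2)"
    unfolding h2 using q1 g1 q2 g2 qg by simp
  have Eh: "expectation (\<lambda>x. (h x)\<^sup>2) = (A - m\<^sup>2) - 2 * k * (C - m * n) + k\<^sup>2 * (B - n\<^sup>2)"
  proof -
    have "expectation (\<lambda>x. (h x)\<^sup>2) = A + k\<^sup>2 * B - 2 * k * C - 2 * (m - k * n) * m
        + 2 * k * (m - k * n) * n + (m - k * n)\<^sup>2"
      unfolding h2 using q1 g1 q2 g2 qg by (simp add: moments prob_space)
    then show ?thesis
      by (simp add: power2_eq_square algebra_simps)
  qed
  have "(\<lambda>x. (q x - g x)\<^sup>2) = (\<lambda>x. (q x)\<^sup>2 - 2 * (q x * g x) + (g x)\<^sup>2)"
    by (simp add: fun_eq_iff power2_eq_square algebra_simps)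
  then have Ed: "expectation (\<lambda>x. (q x - g x)\<^sup>2) = A - 2 * C + B"
    using q2 g2 qg by (simp add: moments)
  \<comment> \<open>The first identity makes the cross terms of h^2 and of the penalty match; the
    second gives the coefficient left on the variance of \<open>g\<close>.\<close>
  have k: "(l + \<gamma>) * k = l" "l * \<gamma> / (l + \<gamma>) = l - (l + \<gamma>) * k\<^sup>2"
    using assms(5,6) by (simp_all add: k_def power2_eq_square divide_simps) (simp add: algebra_simps)
  have "(l + \<gamma>) * expectation (\<lambda>x. (h x)\<^sup>2)
      = (l + \<gamma>) * (A - m\<^sup>2) - 2 * ((l + \<gamma>) * k) * (C - m * n) + (l + \<gamma>) * k\<^sup>2 * (B - n\<^sup>2)"
    by (simp add: Eh algebra_simps)
  moreover have "l * (m - n + 1 / (2 * l))\<^sup>2 = l * (m - n)\<^sup>2 + (m - n) + 1 / (4 * l)"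
    using assms(5) by (simp add: power2_eq_square field_simps)
  ultimately show "expectation q + \<gamma> * (expectation (\<lambda>x. (q x)\<^sup>2) - (expectation q)\<^sup>2)
           + l * expectation (\<lambda>x. (q x - g x)\<^sup>2)
         = expectation g + l * \<gamma> / (l + \<gamma>) * (expectation (\<lambda>x. (g x)\<^sup>2) - (expectation g)\<^sup>2)
           - 1 / (4 * l) + (l + \<gamma>) * expectation (\<lambda>x. (h x)\<^sup>2)
           + l * (expectation q - expectation g + 1 / (2 * l))\<^sup>2"
    unfolding k Ed moments by (simp add: power2_eq_square algebra_simps)
qed

section \<open>The dual multiplier and its angle\<close>

text \<open>The second summand supplies the strict decrease, so \<open>c\<close> may be
  zero.\<close>

lemma multiplier_antimono:
  fixes c \<gamma> x y :: real
  assumes "0 < x" "x < y" "\<gamma> > 0"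
  shows "c\<^sup>2 / (y + \<gamma>)\<^sup>2 + 1 / (4 * y\<^sup>2) < c\<^sup>2 / (x + \<gamma>)\<^sup>2 + 1 / (4 * x\<^sup>2)"
proof -
  have "x\<^sup>2 < y\<^sup>2" "(x + \<gamma>)\<^sup>2 \<le> (y + \<gamma>)\<^sup>2"
    using assms by (auto intro!: power_strict_mono power_mono)
  then show ?thesis
    using assms by (intro add_le_less_mono divide_left_mono divide_strict_left_mono) auto
qed

lemma ex1_multiplier:
  fixes c \<gamma> \<epsilon> :: real
  assumes "\<gamma> > 0" "\<epsilon> > 0"
  shows "\<exists>!l. l > 0 \<and> c\<^sup>2 / (l + \<gamma>)\<^sup>2 + 1 / (4 * l\<^sup>2) = \<epsilon>"
proof (rule ex_ex1I)
  define \<phi> where "\<phi> l = c\<^sup>2 / (l + \<gamma>)\<^sup>2 + 1 / (4 * l\<^sup>2)" for l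
  \<comment> \<open>Brackets for the intermediate value theorem: at \<open>a\<close> the second
    summand alone equals \<epsilon>; at \<open>b\<close>, dropping \<gamma> from the denominator
    bounds the whole sum by \<epsilon>.\<close>
  define a b where "a = sqrt (1 / 4 / \<epsilon>)" and "b = sqrt ((c\<^sup>2 + 1 / 4) / \<epsilon>)"
  have "1 / 4 / \<epsilon> \<le> (c\<^sup>2 + 1 / 4) / \<epsilon>"
    using assms by (intro divide_right_mono) auto
  then have ab: "0 < a" "a \<le> b"
    unfolding a_def b_def using assms by (auto intro: real_sqrt_le_mono)
  have sq: "a\<^sup>2 = 1 / 4 / \<epsilon>" "b\<^sup>2 = (c\<^sup>2 + 1 / 4) / \<epsilon>"
    using assms by (auto simp: a_def b_def)
  have "1 / (4 * a\<^sup>2) = \<epsilon>"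
    using assms by (simp add: sq)
  then have "\<epsilon> \<le> \<phi> a"
    by (simp add: \<phi>_def)
  have "\<phi> b \<le> c\<^sup>2 / b\<^sup>2 + 1 / (4 * b\<^sup>2)"
    unfolding \<phi>_def using ab assms by (intro add_right_mono divide_left_mono power_mono) auto
  also have "\<dots> = (c\<^sup>2 + 1 / 4) / b\<^sup>2"
    using ab by (simp add: field_simps)
  also have "\<dots> = \<epsilon>"
    using assms zero_le_power2[of c] by (simp add: sq add_nonneg_eq_0_iff)
  finally have "\<phi> b \<le> \<epsilon>" .
  moreover have "isCont \<phi> x" if "a \<le> x \<and> x \<le> b" for x
    unfolding \<phi>_def using that ab assms by (intro continuous_intros) auto
  ultimately obtain l where "a \<le> l" "\<phi> l = \<epsilon>"
    using IVT2[of \<phi> b \<epsilon> a] ab \<open>\<epsilon> \<le> \<phi> a\<close> by blast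
  then show "\<exists>l. l > 0 \<and> c\<^sup>2 / (l + \<gamma>)\<^sup>2 + 1 / (4 * l\<^sup>2) = \<epsilon>"
    using ab by (intro exI[of _ l]) (auto simp: \<phi>_def)
next
  show "x = y" if "x > 0 \<and> c\<^sup>2 / (x + \<gamma>)\<^sup>2 + 1 / (4 * x\<^sup>2) = \<epsilon>"
    "y > 0 \<and> c\<^sup>2 / (y + \<gamma>)\<^sup>2 + 1 / (4 * y\<^sup>2) = \<epsilon>" for x y
    using that multiplier_antimono[of x y \<gamma> c] multiplier_antimono[of y x \<gamma> c] assms
    by (cases x y rule: linorder_cases) auto
qed

text \<open>
  With multiplier \<open>l\<close>, the optimal mean shift is \<open>-1 / (2 * l)\<close> and the optimal change of the
  standard deviation is \<open>-(\<gamma> * \<sigma>) / (l + \<gamma>)\<close>; \<open>\<theta>\<close> is the polar angle of this pair.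
\<close>

lemma angle_equation_iff_multiplier:
  fixes \<sigma> \<gamma> r \<theta> :: real
  assumes pos: "\<sigma> > 0" "\<gamma> > 0" "r > 0" and \<theta>: "\<theta> \<in> {pi<..<3/2 * pi}"
  shows "tan \<theta> - 2 * \<gamma> * \<sigma> - 2 * \<gamma> * r * sin \<theta> = 0 \<longleftrightarrow>
    (\<exists>l>0. r * cos \<theta> = - (1 / (2 * l)) \<and> r * sin \<theta> = - (\<gamma> * \<sigma> / (l + \<gamma>)))"
proof -
  have "0 < cos (\<theta> - pi)"
    using \<theta> by (intro cos_gt_zero) auto
  then have cos: "cos \<theta> < 0"
    by (simp add: cos_diff)
  show ?thesis
  proof
    assume eq: "tan \<theta> - 2 * \<gamma> * \<sigma> - 2 * \<gamma> * r * sin \<theta> = 0"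
    \<comment> \<open>The cosine equation forces this value, which is positive because the cosine is
      negative in the third quadrant.\<close>
    define l where "l = - (1 / (2 * (r * cos \<theta>)))"
    have rc: "r * cos \<theta> < 0"
      using pos cos by (simp add: mult_pos_neg)
    then have l: "l > 0"
      by (simp add: l_def divide_less_0_iff)
    \<comment> \<open>As a quotient of the two coordinates, the tangent is
      \<open>- 2 * l * (r * sin \<theta>)\<close>, so the angle equation becomes linear in
      \<open>r * sin \<theta>\<close>.\<close>
    have "tan \<theta> = (r * sin \<theta>) / (r * cos \<theta>)"
      using pos by (simp add: tan_def)
    also have "\<dots> = - 2 * l * (r * sin \<theta>)"
      by (simp add: l_def)
    finally have "(r * sin \<theta>) * (l + \<gamma>) = - (\<gamma> * \<sigma>)"
      using eq by (simp add: algebra_simps)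
    then have "r * sin \<theta> = - (\<gamma> * \<sigma> / (l + \<gamma>))"
      using l pos by (simp add: field_simps)
    moreover have "r * cos \<theta> = - (1 / (2 * l))"
      using rc by (simp add: l_def)
    ultimately show "\<exists>l>0. r * cos \<theta> = - (1 / (2 * l)) \<and> r * sin \<theta> = - (\<gamma> * \<sigma> / (l + \<gamma>))"
      using l by blast
  next
    assume "\<exists>l>0. r * cos \<theta> = - (1 / (2 * l)) \<and> r * sin \<theta> = - (\<gamma> * \<sigma> / (l + \<gamma>))"
    then obtain l where l: "l > 0" "r * cos \<theta> = - (1 / (2 * l))" "r * sin \<theta> = - (\<gamma> * \<sigma> / (l + \<gamma>))"
      by blast
    have "tan \<theta> = (r * sin \<theta>) / (r * cos \<theta>)"
      using pos by (simp add: tan_def)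
    also have "\<dots> = 2 * l * (\<gamma> * \<sigma> / (l + \<gamma>))"
      by (simp add: l)
    finally have "tan \<theta> - 2 * \<gamma> * \<sigma> - 2 * \<gamma> * (r * sin \<theta>) = 0"
      unfolding l(3) using l(1) pos by (simp add: field_simps)
    then show "tan \<theta> - 2 * \<gamma> * \<sigma> - 2 * \<gamma> * r * sin \<theta> = 0"
      by (simp add: mult.assoc)
  qed
qed

lemma ex_angle_third_quadrant:
  fixes a b :: real
  assumes "a > 0" "b > 0" "a\<^sup>2 + b\<^sup>2 = 1"
  shows "\<exists>\<theta>\<in>{pi<..<3/2 * pi}. cos \<theta> = - a \<and> sin \<theta> = - b"
proof -
  obtain t where t: "0 \<le> t" "t \<le> pi / 2" "a = cos t" "b = sin t"
    using sincos_total_pi_half[of a b] assms by auto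
  have "sin t \<noteq> sin 0" "cos t \<noteq> cos (pi / 2)"
    using t assms by auto
  then have "t \<noteq> 0" "t \<noteq> pi / 2"
    by metis+
  then show ?thesis
    using t by (intro bexI[of _ "pi + t"]) (auto simp: cos_add sin_add)
qed

text \<open>Subtracting pi moves the arc into [0, pi], where cosine is injective. Hence the mean
  shift alone already fixes the angle.\<close>

lemma inj_on_cos_third_quadrant: "inj_on cos {pi<..<3/2 * pi}"
proof (rule inj_onI)
  fix x y :: real
  assume "x \<in> {pi<..<3/2 * pi}" "y \<in> {pi<..<3/2 * pi}" "cos x = cos y"
  then have "cos (x - pi) = cos (y - pi)" "0 \<le> x - pi" "x - pi \<le> pi" "0 \<le> y - pi" "y - pi \<le> pi"
    by (auto simp: cos_diff)
  then show "x = y"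
    using cos_inj_pi[of "x - pi" "y - pi"] by linarith
qed

section \<open>The completed-square identity for CDFs\<close>

lemma penalized_mean_variance:
  fixes F G :: "real \<Rightarrow> real" and l \<gamma> :: real
  assumes F: "is_cdf F" "finite_second_moment F" and G: "is_cdf G" "finite_second_moment G"
    and pos: "l > 0" "\<gamma> > 0"
  defines "h \<equiv> \<lambda>t. (quantile F t - cdf_mean F) - l / (l + \<gamma>) * (quantile G t - cdf_mean G)"
  shows "integrable unit_interval (\<lambda>t. (h t)\<^sup>2)"
    and "mean_variance \<gamma> F + l * (wasserstein2 F G)\<^sup>2
         = cdf_mean G + l * \<gamma> / (l + \<gamma>) * cdf_variance G - 1 / (4 * l)
           + (l + \<gamma>) * (\<integral>t. (h t)\<^sup>2 \<partial>unit_interval)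
           + l * (cdf_mean F - cdf_mean G + 1 / (2 * l))\<^sup>2"
proof -
  interpret prob_space unit_interval
    by (rule prob_space_unit_interval)
  have W: "(wasserstein2 F G)\<^sup>2 = (\<integral>t. (quantile F t - quantile G t)\<^sup>2 \<partial>unit_interval)"
    unfolding wasserstein2_def set_integral_unit_interval
    by (simp add: integral_nonneg_AE)
  note * = mean_variance_complete_squares[OF borel_measurable_quantile[OF F(1)]
      borel_measurable_quantile[OF G(1)], unfolded finite_second_moment_iff_quantile[symmetric, OF F(1)]
      finite_second_moment_iff_quantile[symmetric, OF G(1)], OF F(2) G(2) pos]
  show "integrable unit_interval (\<lambda>t. (h t)\<^sup>2)"
    using *(1) by (simp add: h_def cdf_mean_def set_integral_unit_interval)
  show "mean_variance \<gamma> F + l * (wasserstein2 F G)\<^sup>2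
         = cdf_mean G + l * \<gamma> / (l + \<gamma>) * cdf_variance G - 1 / (4 * l)
           + (l + \<gamma>) * (\<integral>t. (h t)\<^sup>2 \<partial>unit_interval)
           + l * (cdf_mean F - cdf_mean G + 1 / (2 * l))\<^sup>2"
    using *(2) by (simp add: W h_def mean_variance_def cdf_variance_def cdf_mean_def set_integral_unit_interval)
qed

section \<open>The best-case distribution\<close>

locale best_case =
  fixes G :: "real \<Rightarrow> real" and \<epsilon> \<gamma> l :: real
  assumes G: "is_cdf G" "finite_second_moment G"
    and l: "l > 0" and \<gamma>: "\<gamma> > 0"
    and multiplier: "\<gamma>\<^sup>2 * cdf_variance G / (l + \<gamma>)\<^sup>2 + 1 / (4 * l\<^sup>2) = \<epsilon>"
begin

interpretation prob_space unit_interval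
  by (rule prob_space_unit_interval)

definition shrink :: real where "shrink = l / (l + \<gamma>)"

text \<open>If both squares vanish, the quantile function is (E g - 1 / (2l)) +
  \<open>shrink\<close> * (g - E g); this is its constant term once \<open>g\<close> is separated
  out.\<close>

definition offset :: real where "offset = cdf_mean G - 1 / (2 * l) - shrink * cdf_mean G"

definition best_cdf :: "real \<Rightarrow> real" where
  "best_cdf x = G ((x - offset) / shrink)"

text \<open>The Lagrange dual function at \<open>l\<close>: the penalized identity without its two
  squares, minus the price \<open>l * \<epsilon>\<close> of the constraint.\<close>

definition best_value :: real where
  "best_value = cdf_mean G + l * \<gamma> / (l + \<gamma>) * cdf_variance G - 1 / (4 * l) - l * \<epsilon>"

lemma shrink_pos: "shrink > 0"
  using l \<gamma> by (simp add: shrink_def)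

lemma is_cdf_best_cdf: "is_cdf best_cdf"
  using is_cdf_affine[OF G(1) shrink_pos, of offset] by (simp add: best_cdf_def[abs_def])

lemma quantile_best_cdf:
  "0 < t \<Longrightarrow> t < 1 \<Longrightarrow> quantile best_cdf t = offset + shrink * quantile G t"
  using quantile_affine[OF G(1) shrink_pos, of t offset] by (simp add: best_cdf_def[abs_def])

lemma integrable_quantile_G:
  "integrable unit_interval (\<lambda>t. (quantile G t)\<^sup>2)" "integrable unit_interval (quantile G)"
proof -
  show g2: "integrable unit_interval (\<lambda>t. (quantile G t)\<^sup>2)"
    using G finite_second_moment_iff_quantile by blast
  show "integrable unit_interval (quantile G)"
    using borel_measurable_quantile[OF G(1)] g2 by (rule square_integrable_imp_integrable)
qed

lemma finite_second_moment_best_cdf: "finite_second_moment best_cdf"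
proof -
  have "integrable unit_interval (\<lambda>t. offset\<^sup>2 + 2 * offset * shrink * quantile G t
      + shrink\<^sup>2 * (quantile G t)\<^sup>2)"
    using integrable_quantile_G by simp
  moreover have "(quantile best_cdf t)\<^sup>2 = offset\<^sup>2 + 2 * offset * shrink * quantile G t
      + shrink\<^sup>2 * (quantile G t)\<^sup>2" if "t \<in> space unit_interval" for t
    using that quantile_best_cdf[of t]
    by (simp add: space_restrict_space power2_eq_square algebra_simps)
  ultimately show ?thesis
    unfolding finite_second_moment_iff_quantile[OF is_cdf_best_cdf]
    by (subst Bochner_Integration.integrable_cong[OF refl])
qed

lemma cdf_mean_best_cdf: "cdf_mean best_cdf = cdf_mean G - 1 / (2 * l)"
proof -
  have "cdf_mean best_cdf = (\<integral>t. offset + shrink * quantile G t \<partial>unit_interval)"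
    unfolding cdf_mean_def set_integral_unit_interval
    by (intro Bochner_Integration.integral_cong) (auto simp: quantile_best_cdf space_restrict_space)
  also have "\<dots> = offset + shrink * cdf_mean G"
    using integrable_quantile_G prob_space
    by (simp add: cdf_mean_def set_integral_unit_interval)
  finally show ?thesis
    by (simp add: offset_def)
qed

text \<open>The constraint is tight: the quantile difference is -1 / (2l) - k (g - E g) with k =
  \<gamma> / (l + \<gamma>), and the integral of its square, k^2 Var g + 1 / (4 l^2), is the left
  side of \<open>multiplier\<close>.\<close>

lemma wasserstein2_best_cdf: "(wasserstein2 best_cdf G)\<^sup>2 = \<epsilon>"
proof -
  let ?n = "cdf_mean G"
  let ?k = "\<gamma> / (l + \<gamma>)"
  have k: "shrink = 1 - ?k"
    using l \<gamma> by (simp add: shrink_def field_simps)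
  have "(wasserstein2 best_cdf G)\<^sup>2
      = (\<integral>t. (quantile best_cdf t - quantile G t)\<^sup>2 \<partial>unit_interval)"
    unfolding wasserstein2_def set_integral_unit_interval by (simp add: integral_nonneg_AE)
  also have "\<dots> = (\<integral>t. (?k * ?n - 1 / (2 * l))\<^sup>2 - 2 * (?k * ?n - 1 / (2 * l)) * ?k * quantile G t
      + ?k\<^sup>2 * (quantile G t)\<^sup>2 \<partial>unit_interval)"
  proof (intro Bochner_Integration.integral_cong refl)
    fix t assume "t \<in> space unit_interval"
    then have "quantile best_cdf t - quantile G t = (?k * ?n - 1 / (2 * l)) - ?k * quantile G t"
      by (simp add: quantile_best_cdf space_restrict_space offset_def k left_diff_distrib)
    moreover have "(a - k * x)\<^sup>2 = a\<^sup>2 - 2 * a * k * x + k\<^sup>2 * x\<^sup>2" for a k x :: real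
      by (simp add: power2_diff power_mult_distrib)
    ultimately show "(quantile best_cdf t - quantile G t)\<^sup>2 = (?k * ?n - 1 / (2 * l))\<^sup>2
        - 2 * (?k * ?n - 1 / (2 * l)) * ?k * quantile G t + ?k\<^sup>2 * (quantile G t)\<^sup>2"
      by (simp only:)
  qed
  also have "\<dots> = (?k * ?n - 1 / (2 * l))\<^sup>2 - 2 * (?k * ?n - 1 / (2 * l)) * ?k * ?n
      + ?k\<^sup>2 * (\<integral>t. (quantile G t)\<^sup>2 \<partial>unit_interval)"
    using integrable_quantile_G prob_space by (simp add: cdf_mean_def set_integral_unit_interval)
  also have "\<dots> = ?k\<^sup>2 * ((\<integral>t. (quantile G t)\<^sup>2 \<partial>unit_interval) - ?n\<^sup>2) + (1 / (2 * l))\<^sup>2"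
  proof -
    have "(k * n - d)\<^sup>2 - 2 * (k * n - d) * k * n + k\<^sup>2 * B = k\<^sup>2 * (B - n\<^sup>2) + d\<^sup>2" for k n d B :: real
      by (simp add: power2_eq_square algebra_simps)
    then show ?thesis .
  qed
  also have "\<dots> = \<epsilon>"
    unfolding multiplier[symmetric]
    by (simp add: cdf_variance_def cdf_mean_def set_integral_unit_interval power_divide power_mult_distrib)
  finally show ?thesis .
qed

lemma best_cdf_in_ball: "best_cdf \<in> wasserstein_ball G \<epsilon>"
proof -
  have "wasserstein2 best_cdf G \<le> sqrt \<epsilon>"
    by (rule real_le_rsqrt) (simp add: wasserstein2_best_cdf)
  then show ?thesis
    by (simp add: wasserstein_ball_def is_cdf_best_cdf finite_second_moment_best_cdf)
qed

text \<open>The residual vanishes pointwise on the open interval, the mean shift kills the other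
  square, and tightness turns the penalty into \<open>l * \<epsilon>\<close>.\<close>

lemma mean_variance_best_cdf: "mean_variance \<gamma> best_cdf = best_value"
proof -
  have "(\<integral>t. ((quantile best_cdf t - cdf_mean best_cdf)
      - l / (l + \<gamma>) * (quantile G t - cdf_mean G))\<^sup>2 \<partial>unit_interval) = (\<integral>t. 0 \<partial>unit_interval)"
    by (intro Bochner_Integration.integral_cong)
       (auto simp: quantile_best_cdf cdf_mean_best_cdf offset_def space_restrict_space
          shrink_def[symmetric] right_diff_distrib)
  then show ?thesis
    using penalized_mean_variance(2)[OF is_cdf_best_cdf finite_second_moment_best_cdf G l \<gamma>]
    by (simp add: wasserstein2_best_cdf best_value_def cdf_mean_best_cdf)
qed

text \<open>Weak duality; in the equality case both squares of the penalized identity vanish.\<close>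

lemma
  assumes "F \<in> wasserstein_ball G \<epsilon>"
  shows best_value_le: "best_value \<le> mean_variance \<gamma> F"
    and eq_best_cdf: "mean_variance \<gamma> F \<le> best_value \<Longrightarrow> F = best_cdf"
proof -
  have F: "is_cdf F" "finite_second_moment F" and "wasserstein2 F G \<le> sqrt \<epsilon>"
    using assms by (auto simp: wasserstein_ball_def)
  moreover have "0 \<le> wasserstein2 F G"
    unfolding wasserstein2_def set_integral_unit_interval by (simp add: integral_nonneg_AE)
  \<comment> \<open>The sign of \<epsilon> comes from its being an attained squared
    distance.\<close>
  moreover have "0 \<le> \<epsilon>"
    using wasserstein2_best_cdf zero_le_power2 by metis
  ultimately have "(wasserstein2 F G)\<^sup>2 \<le> \<epsilon>"
    by (metis power_mono real_sqrt_pow2)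
  then have W: "l * (wasserstein2 F G)\<^sup>2 \<le> l * \<epsilon>"
    using l by simp
  define h where
    "h t = (quantile F t - cdf_mean F) - l / (l + \<gamma>) * (quantile G t - cdf_mean G)" for t
  define a where "a = cdf_mean F - cdf_mean G + 1 / (2 * l)"
  note pen = penalized_mean_variance[OF F G l \<gamma>, folded h_def a_def]
  have nonneg: "0 \<le> (l + \<gamma>) * (\<integral>t. (h t)\<^sup>2 \<partial>unit_interval)" "0 \<le> l * a\<^sup>2"
    using l \<gamma> by (auto intro!: mult_nonneg_nonneg integral_nonneg_AE)
  show "best_value \<le> mean_variance \<gamma> F"
    using pen(2) W nonneg by (simp add: best_value_def)
  assume "mean_variance \<gamma> F \<le> best_value"
  then have "(l + \<gamma>) * (\<integral>t. (h t)\<^sup>2 \<partial>unit_interval) = 0" "l * a\<^sup>2 = 0"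
    using pen(2) W nonneg unfolding best_value_def by linarith+
  then have "(\<integral>t. (h t)\<^sup>2 \<partial>unit_interval) = 0" and a: "a = 0"
    using l \<gamma> by auto
  then have "AE t in unit_interval. (h t)\<^sup>2 = 0"
    using integral_nonneg_eq_0_iff_AE[OF pen(1)] by simp
  \<comment> \<open>Here \<open>a = 0\<close> fixes the mean of \<open>F\<close>, and a vanishing
    \<open>h\<close> then gives the affine formula. \<open>AE_space\<close> supplies 0 < t < 1, as
    required by \<open>quantile_best_cdf\<close>.\<close>
  then have "AE t in unit_interval. quantile F t = quantile best_cdf t"
    using AE_space
  proof eventually_elim
    case (elim t)
    then show ?case
      using a by (simp add: h_def a_def quantile_best_cdf offset_def space_restrict_space
          shrink_def[symmetric] right_diff_distrib)
  qed
  then show "F = best_cdf"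
    by (rule cdf_eqI_AE_quantile[OF F(1) is_cdf_best_cdf])
qed

lemma is_arg_min_iff_best_cdf:
  "is_arg_min (mean_variance \<gamma>) (\<lambda>F. F \<in> wasserstein_ball G \<epsilon>) F \<longleftrightarrow> F = best_cdf"
  using best_value_le[of F] eq_best_cdf[of F] best_value_le best_cdf_in_ball mean_variance_best_cdf
  by (auto simp: is_arg_min_linorder)

text \<open>The infimum is attained at \<open>best_cdf\<close>, so no separate argument for
  boundedness below is required.\<close>

lemma INF_mean_variance: "(INF F\<in>wasserstein_ball G \<epsilon>. mean_variance \<gamma> F) = best_value"
  using best_cdf_in_ball mean_variance_best_cdf best_value_le
  by (intro cInf_eq_minimum) (auto simp: rev_image_eqI)

end

section \<open>Assembling the primal, dual and polar descriptions\<close>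

theorem theorem3p2:
  fixes G :: "real \<Rightarrow> real" and \<mu> \<sigma> \<epsilon> \<gamma> :: real
  assumes "is_cdf G" and "finite_second_moment G"
    and "\<mu> = cdf_mean G" and "\<sigma> = sqrt (cdf_variance G)" and "\<sigma> > 0"
    and "\<epsilon> > 0" and "\<gamma> > 0"
  shows
    "(\<exists>!\<theta>. \<theta> \<in> {pi<..<3/2 * pi} \<and> tan \<theta> - 2 * \<gamma> * \<sigma> - 2 * \<gamma> * sqrt \<epsilon> * sin \<theta> = 0)
     \<and> (\<exists>!F. is_arg_min (mean_variance \<gamma>) (\<lambda>F. F \<in> wasserstein_ball G \<epsilon>) F)
     \<and> (\<forall>\<theta> F. \<theta> \<in> {pi<..<3/2 * pi} \<and> tan \<theta> - 2 * \<gamma> * \<sigma> - 2 * \<gamma> * sqrt \<epsilon> * sin \<theta> = 0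
           \<and> is_arg_min (mean_variance \<gamma>) (\<lambda>F. F \<in> wasserstein_ball G \<epsilon>) F
         \<longrightarrow> (\<forall>t\<in>{0<..<1}. quantile F t =
               (\<mu> + sqrt \<epsilon> * cos \<theta>) + (\<sigma> + sqrt \<epsilon> * sin \<theta>) * ((quantile G t - \<mu>) / \<sigma>)))
     \<and> (\<exists>!l. l > 0 \<and> \<gamma>\<^sup>2 * \<sigma>\<^sup>2 / (l + \<gamma>)\<^sup>2 + 1 / (4 * l\<^sup>2) = \<epsilon>)
     \<and> (\<forall>l. l > 0 \<and> \<gamma>\<^sup>2 * \<sigma>\<^sup>2 / (l + \<gamma>)\<^sup>2 + 1 / (4 * l\<^sup>2) = \<epsilon>
         \<longrightarrow> (INF F\<in>wasserstein_ball G \<epsilon>. mean_variance \<gamma> F) =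
               \<mu> + l * \<gamma> / (l + \<gamma>) * \<sigma>\<^sup>2 - 1 / (4 * l) - l * \<epsilon>)"
proof -
  let ?root = "\<lambda>\<theta>. \<theta> \<in> {pi<..<3/2 * pi} \<and> tan \<theta> - 2 * \<gamma> * \<sigma> - 2 * \<gamma> * sqrt \<epsilon> * sin \<theta> = 0"
  let ?mult = "\<lambda>l. l > 0 \<and> \<gamma>\<^sup>2 * \<sigma>\<^sup>2 / (l + \<gamma>)\<^sup>2 + 1 / (4 * l\<^sup>2) = \<epsilon>"
  have \<sigma>2: "\<sigma>\<^sup>2 = cdf_variance G"
    using assms(4,5) by simp
  have ex1: "\<exists>!l. ?mult l"
    using ex1_multiplier[of \<gamma> \<epsilon> "\<gamma> * \<sigma>"] assms(6,7) by (simp add: power_mult_distrib)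
  then obtain l where l_mult: "?mult l"
    by (rule ex1E)
  have uniq: "k = l" if "?mult k" for k
    by (rule trans[OF the1_equality[OF ex1 that, symmetric] the1_equality[OF ex1 l_mult]])
  from l_mult interpret best_case G \<epsilon> \<gamma> l
    using assms by unfold_locales (auto simp: \<sigma>2)
  have best_value_eq: "best_value = \<mu> + l * \<gamma> / (l + \<gamma>) * \<sigma>\<^sup>2 - 1 / (4 * l) - l * \<epsilon>"
    by (simp add: best_value_def \<sigma>2 assms(3))
  define r where "r = sqrt \<epsilon>"
  have r: "r > 0" "r\<^sup>2 = \<epsilon>"
    using assms(6) by (simp_all add: r_def)
  have mult: "(1 / (2 * k))\<^sup>2 + (\<gamma> * \<sigma> / (k + \<gamma>))\<^sup>2
      = \<gamma>\<^sup>2 * \<sigma>\<^sup>2 / (k + \<gamma>)\<^sup>2 + 1 / (4 * k\<^sup>2)" for k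
    by (simp add: power_divide power_mult_distrib)
  \<comment> \<open>The multiplier supplied by the angle equation depends a priori on \<theta>.
    Squaring and adding the two coordinates gives the dual equation, so that multiplier is always
    the fixed \<open>l\<close>.\<close>
  have root: "?root \<theta> \<longleftrightarrow> \<theta> \<in> {pi<..<3/2 * pi} \<and>
      r * cos \<theta> = - (1 / (2 * l)) \<and> r * sin \<theta> = - (\<gamma> * \<sigma> / (l + \<gamma>))" for \<theta>
  proof (cases "\<theta> \<in> {pi<..<3/2 * pi}")
    case True
    have "k = l" if k: "k > 0" "r * cos \<theta> = - (1 / (2 * k))" "r * sin \<theta> = - (\<gamma> * \<sigma> / (k + \<gamma>))" for k
    proof -
      have "(r * cos \<theta>)\<^sup>2 + (r * sin \<theta>)\<^sup>2 = \<epsilon>"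
        using r by (simp add: power_mult_distrib flip: distrib_left)
      then have "?mult k"
        using k mult[of k] by simp
      then show ?thesis
        by (rule uniq)
    qed
    with l have "(\<exists>k>0. r * cos \<theta> = - (1 / (2 * k)) \<and> r * sin \<theta> = - (\<gamma> * \<sigma> / (k + \<gamma>))) \<longleftrightarrow>
        r * cos \<theta> = - (1 / (2 * l)) \<and> r * sin \<theta> = - (\<gamma> * \<sigma> / (l + \<gamma>))"
      by metis
    then show ?thesis
      using True angle_equation_iff_multiplier[OF assms(5,7) r(1) True] by (simp add: r_def)
  qed auto
  \<comment> \<open>Divided by \<open>r\<close>, the dual equation says that the normalized shifts
    lie on the unit circle; negating both coordinates puts them in the third quadrant.\<close>
  have "(1 / (2 * l) / r)\<^sup>2 + (\<gamma> * \<sigma> / (l + \<gamma>) / r)\<^sup>2 = 1"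
    unfolding power_divide[of _ r] add_divide_distrib[symmetric] mult conjunct2[OF l_mult]
    using r assms(6) by simp
  moreover have "1 / (2 * l) / r > 0" "\<gamma> * \<sigma> / (l + \<gamma>) / r > 0"
    using l r assms(5,7) by simp_all
  ultimately obtain \<theta> where \<theta>: "\<theta> \<in> {pi<..<3/2 * pi}" "cos \<theta> = - (1 / (2 * l) / r)"
    "sin \<theta> = - (\<gamma> * \<sigma> / (l + \<gamma>) / r)"
    using ex_angle_third_quadrant by metis
  have "?root \<theta>"
    unfolding root using \<theta> r by simp
  moreover have "\<theta>' = \<theta>" if "?root \<theta>'" for \<theta>'
  proof (rule inj_onD[OF inj_on_cos_third_quadrant])
    have "r * cos \<theta>' = r * cos \<theta>"
      using \<open>?root \<theta>\<close> that unfolding root by argo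
    then show "cos \<theta>' = cos \<theta>"
      using r(1) by simp
  qed (use \<theta> that in auto)
  ultimately have "\<exists>!\<theta>. ?root \<theta>"
    by (intro ex1I)
  moreover have "quantile best_cdf t = (\<mu> + r * cos \<theta>) + (\<sigma> + r * sin \<theta>) * ((quantile G t - \<mu>) / \<sigma>)"
    if "?root \<theta>" and t: "0 < t" "t < 1" for \<theta> t
  proof -
    have "r * cos \<theta> = - (1 / (2 * l))" "r * sin \<theta> = - (\<gamma> * \<sigma> / (l + \<gamma>))"
      using that(1) unfolding root by auto
    \<comment> \<open>The new standard deviation is \<open>shrink * \<sigma>\<close>, which makes
      the standardized form in \<theta> agree with
      \<open>offset + shrink * quantile G t\<close>.\<close>
    moreover have "\<sigma> - \<gamma> * \<sigma> / (l + \<gamma>) = shrink * \<sigma>"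
      using l assms(7) by (simp add: shrink_def field_simps)
    moreover have "shrink * \<sigma> * ((quantile G t - \<mu>) / \<sigma>) = shrink * quantile G t - shrink * \<mu>"
      using assms(5) by (simp flip: right_diff_distrib)
    ultimately show ?thesis
      by (simp add: quantile_best_cdf[OF t] offset_def assms(3)[symmetric])
  qed
  moreover have "(INF F\<in>wasserstein_ball G \<epsilon>. mean_variance \<gamma> F) =
      \<mu> + k * \<gamma> / (k + \<gamma>) * \<sigma>\<^sup>2 - 1 / (4 * k) - k * \<epsilon>" if "?mult k" for k
    using uniq[OF that] INF_mean_variance best_value_eq by simp
  ultimately show ?thesis
    using ex1 unfolding is_arg_min_iff_best_cdf r_def by simp
qed

end
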